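(* Let $(\mu,\nu)$ be a pair of Borel probability measures on $\mathbb{R}$. If $\pi^*$ is a cluster point (for weak convergence, as $\varepsilon\to0^+$) of $(\pi_\varepsilon)_{\varepsilon>0}$, then for all Borel sets $B_1,B_2\subset\mathbb{R}$ such that $B_1\times B_2\subset\{(x,y)\in\mathbb{R}^2:x\le y\}$ or $B_1\times B_2\subset\{(x,y)\in\mathbb{R}^2:x\ge y\}$, the restriction of $\pi^*$ to $B_1\times B_2$ is a product measure.
   Context: $\mathrm{Marg}(\mu,\nu)$ is the set of positive Borel measures on $\mathbb{R}^2$ with marginals $\mu$ and $\nu$. For $\varepsilon>0$, $\pi\in\mathrm{Marg}(\mu,\nu)$ is $\varepsilon$-cyclically invariant if $\pi=f\cdot(\mu\otimes\nu)$ for some $f:\mathbb{R}^2\to[0,+\infty[$ such that for all $n\ge1$ and all $((x_i,y_i))_{1\le i\le n}\in(\mathbb{R}^2)^n$, $\prod_{i=1}^n e^{|y_i-x_i|/\varepsilon}f(x_i,y_i)=\prod_{i=1}^n e^{|y_{i+1}-x_i|/\varepsilon}f(x_i,y_{i+1})$ (with $y_{n+1}=y_1$). There is exactly one such plan (known theorem), denoted $\pi_\varepsilon$. If $J_\varepsilon(\pi)=\int|y-x|\,d\pi+\varepsilon\,\mathrm{Ent}(\pi|\mu\otimes\nu)$ has finite infimum over $\mathrm{Marg}(\mu,\nu)$ (where $\mathrm{Ent}(\pi|\mu\otimes\nu)=\int\log\frac{d\pi}{d(\mu\otimes\nu)}\,d\pi$ if $\pi\ll\mu\otimes\nu$ and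 $+\infty$ otherwise), then $\pi_\varepsilon$ is its unique minimizer. *)

theory Defs
  imports "HOL-Probability.Probability"
begin

definition Marg :: "real measure \<Rightarrow> real measure \<Rightarrow> (real \<times> real) measure set" where
  "Marg \<mu> \<nu> = {\<pi>. sets \<pi> = sets borel \<and> distr \<pi> borel fst = \<mu> \<and> distr \<pi> borel snd = \<nu>}"

text \<open>The indices of the \<open>n\<close> points run over \<open>0, \<dots>, n - 1\<close>, so that \<open>Suc i mod n\<close>
  is the cyclic successor of \<open>i\<close>. The identity is required at all points,
  not merely almost everywhere.\<close>

definition cyclically_invariant ::
  "real \<Rightarrow> real measure \<Rightarrow> real measure \<Rightarrow> (real \<times> real) measure \<Rightarrow> bool" where
  "cyclically_invariant \<epsilon> \<mu> \<nu> \<pi> \<longleftrightarrow>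
     \<pi> \<in> Marg \<mu> \<nu> \<and>
     (\<exists>f :: real \<times> real \<Rightarrow> real.
        f \<in> borel_measurable borel \<and> (\<forall>z. 0 \<le> f z) \<and>
        \<pi> = density (\<mu> \<Otimes>\<^sub>M \<nu>) (\<lambda>z. ennreal (f z)) \<and>
        (\<forall>n\<ge>1. \<forall>x y :: nat \<Rightarrow> real.
           (\<Prod>i<n. exp (\<bar>y i - x i\<bar> / \<epsilon>) * f (x i, y i)) =
           (\<Prod>i<n. exp (\<bar>y (Suc i mod n) - x i\<bar> / \<epsilon>) * f (x i, y (Suc i mod n)))))"

text \<open>The weak topology on finite Borel measures: the coarsest one for which
  \<open>\<rho> \<mapsto> \<integral>\<phi> d\<rho>\<close> is continuous for every bounded continuous \<open>\<phi>\<close>.\<close>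

definition weak_topology :: "'a::topological_space measure topology" where
  "weak_topology = topology_generated_by
     {{\<rho>. finite_measure \<rho> \<and> sets \<rho> = sets borel \<and> (\<integral>z. \<phi> z \<partial>\<rho>) \<in> U} | (\<phi> :: 'a \<Rightarrow> real) U.
        continuous_on UNIV \<phi> \<and> bounded (range \<phi>) \<and> open U}"

lemma topspace_weak_topology:
  "topspace weak_topology = {\<rho> :: 'a::topological_space measure. finite_measure \<rho> \<and> sets \<rho> = sets borel}"
  (is "?L = ?R")
proof
  show "?L \<subseteq> ?R"
    unfolding weak_topology_def topology_generated_by_topspace by auto
  have "continuous_on UNIV (\<lambda>_::'a. 0::real) \<and> bounded (range (\<lambda>_::'a. 0::real)) \<and> open (UNIV :: real set)"
    by auto
  then show "?R \<subseteq> ?L"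
    unfolding weak_topology_def topology_generated_by_topspace by blast
qed

definition cluster_point :: "'b topology \<Rightarrow> ('a \<Rightarrow> 'b) \<Rightarrow> 'a filter \<Rightarrow> 'b \<Rightarrow> bool" where
  "cluster_point T g F l \<longleftrightarrow>
     l \<in> topspace T \<and> (\<forall>V. openin T V \<and> l \<in> V \<longrightarrow> (\<exists>\<^sub>F x in F. g x \<in> V))"

definition is_product_measure :: "('a \<times> 'b) measure \<Rightarrow> bool" where
  "is_product_measure \<rho> \<longleftrightarrow>
     (\<exists>\<alpha> \<beta>. finite_measure \<alpha> \<and> finite_measure \<beta> \<and> \<rho> = \<alpha> \<Otimes>\<^sub>M \<beta>)"

end

theory Submission imports Defs begin

text \<open>On \<open>B1 \<times> B2\<close> the cost \<open>\<bar>y - x\<bar>\<close> is a sum of a function of \<open>x\<close> and a function of \<open>y\<close>, so the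
  exponentials cancel in the cyclic identity for two points and the density of \<open>\<pi> \<epsilon>\<close> has rank
  one there. Hence \<open>\<rho>(A1 \<times> A2) \<rho>(B1 \<times> B2) = \<rho>(A1 \<times> B2) \<rho>(B1 \<times> A2)\<close> for \<open>\<rho> = \<pi> \<epsilon>\<close> and
  all Borel \<open>A1 \<subseteq> B1\<close>, \<open>A2 \<subseteq> B2\<close>. Because all \<open>\<pi> \<epsilon>\<close> share their marginals, weak convergence
  implies convergence on every Borel rectangle, and the identity passes to the cluster point.\<close>

section \<open>Cluster points and weak convergence\<close>

text \<open>A finer filter plays the role of a convergent subsequence. Meeting \<open>F\<close> with
  the pullback along \<open>g\<close> of the neighbourhoods of \<open>l\<close> forces
  \<open>g\<close> to tend to \<open>l\<close>; the meet is proper because \<open>g\<close> visits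
  every neighbourhood of \<open>l\<close> frequently along \<open>F\<close>.\<close>

lemma cluster_point_imp_limitin:
  assumes "cluster_point T g F l"
  obtains G where "G \<noteq> bot" "G \<le> F" "limitin T g l G"
proof
  let ?G = "inf F (filtercomap g (nhdsin T l))"
  have l: "l \<in> topspace T"
    and freq: "\<And>V. openin T V \<Longrightarrow> l \<in> V \<Longrightarrow> \<exists>\<^sub>F x in F. g x \<in> V"
    using assms by (auto simp: cluster_point_def)
  show "?G \<noteq> bot"
  proof
    assume "?G = bot"
    then obtain P Q R where P: "eventually P F" and Q: "eventually Q (nhdsin T l)"
      and R: "\<And>x. Q (g x) \<Longrightarrow> R x" and PR: "\<And>x. \<not> (P x \<and> R x)"
      unfolding trivial_limit_def eventually_inf eventually_filtercomap by blast
    obtain V where "openin T V" "l \<in> V" "\<forall>x\<in>V. Q x"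
      using Q l by (auto simp: eventually_nhdsin)
    then show False
      using frequently_ex[OF frequently_eventually_frequently[OF freq P]] R PR by blast
  qed
  show "?G \<le> F" by simp
  show "limitin T g l ?G"
    unfolding limitin_def
  proof (intro conjI allI impI l)
    fix U assume "openin T U \<and> l \<in> U"
    then have "eventually (\<lambda>x. x \<in> U) (nhdsin T l)"
      by (auto simp: eventually_nhdsin)
    then show "\<forall>\<^sub>F x in ?G. g x \<in> U"
      by (intro filter_leD[OF inf_le2]) (auto simp: eventually_filtercomap)
  qed
qed

lemma limitin_weak_topology_imp_tendsto_integral:
  fixes \<phi> :: "'a::topological_space \<Rightarrow> real"
  assumes "limitin weak_topology g l G"
    and "continuous_on UNIV \<phi>" "bounded (range \<phi>)"
  shows "((\<lambda>x. \<integral>z. \<phi> z \<partial>g x) \<longlongrightarrow> (\<integral>z. \<phi> z \<partial>l)) G"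
proof (rule topological_tendstoI)
  fix U :: "real set" assume U: "open U" "(\<integral>z. \<phi> z \<partial>l) \<in> U"
  let ?V = "{\<rho>. finite_measure \<rho> \<and> sets \<rho> = sets borel \<and> (\<integral>z. \<phi> z \<partial>\<rho>) \<in> U}"
  have "openin weak_topology ?V"
    unfolding weak_topology_def
    by (rule topology_generated_by_Basis) (use assms U in blast)
  moreover have "l \<in> ?V"
    using U limitin_topspace[OF assms(1)] by (simp add: topspace_weak_topology)
  ultimately have "\<forall>\<^sub>F x in G. g x \<in> ?V"
    using assms(1) by (auto simp: limitin_def)
  then show "\<forall>\<^sub>F x in G. (\<integral>z. \<phi> z \<partial>g x) \<in> U"
    by eventually_elim simp
qed

section \<open>Continuous test functions: approximation and uniqueness\<close>

text \<open>Regularity gives a compact \<open>K\<close> and an open \<open>U\<close> with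
  \<open>K \<subseteq> A \<subseteq> U\<close> and \<open>U - K\<close> of mass below
  \<open>e\<close>. A Urysohn function that is 1 on \<open>K\<close> and 0 off \<open>U\<close>
  differs from the indicator of \<open>A\<close> only on \<open>U - K\<close>, and there by at most
  1.\<close>

lemma indicator_approx_continuous:
  fixes M :: "'a::euclidean_space measure"
  assumes "finite_measure M" "sets M = sets borel" "A \<in> sets borel" "0 < e"
  obtains \<phi> :: "'a \<Rightarrow> real" where "continuous_on UNIV \<phi>" "\<And>x. \<phi> x \<in> {0..1}"
    "(\<integral>x. \<bar>indicator A x - \<phi> x\<bar> \<partial>M) < e"
proof -
  interpret finite_measure M by fact
  have [measurable_cong]: "sets M = sets borel" by fact
  have [measurable]: "A \<in> sets borel" by fact
  have "emeasure M A < emeasure M A + ennreal (e/2)"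
    using \<open>0 < e\<close> by (simp add: emeasure_eq_measure ennreal_less_iff flip: ennreal_plus)
  then have "(INF U \<in> {U. A \<subseteq> U \<and> open U}. emeasure M U) < emeasure M A + ennreal (e/2)"
    using outer_regular[of M A] assms emeasure_finite[of "space M"] by simp
  then obtain U where U: "A \<subseteq> U" "open U" "emeasure M U < emeasure M A + ennreal (e/2)"
    by (auto simp: INF_less_iff)
  have mU: "measure M U < measure M A + e/2"
    using U(3) \<open>0 < e\<close> by (simp add: emeasure_eq_measure ennreal_less_iff flip: ennreal_plus)
  obtain K where K: "K \<subseteq> A" "compact K" "measure M A < measure M K + e/2"
  \<comment> \<open>Inner regularity needs a bound strictly below \<open>emeasure M A\<close>. For
    small \<open>A\<close> the number \<open>measure M A - e/2\<close> is negative and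
    \<open>ennreal\<close> truncates it to 0, which is not strictly smaller when \<open>A\<close> is
    null; the empty set serves instead.\<close>
  proof (cases "measure M A < e/2")
    case True
    then show ?thesis by (intro that[of "{}"]) auto
  next
    case False
    have "ennreal (measure M A - e/2) < emeasure M A"
      using \<open>0 < e\<close> False by (auto simp: emeasure_eq_measure ennreal_less_iff)
    also have "emeasure M A = (SUP K \<in> {K. K \<subseteq> A \<and> compact K}. emeasure M K)"
      using inner_regular[of M A] assms emeasure_finite[of "space M"] by simp
    finally obtain K where "K \<subseteq> A" "compact K" "ennreal (measure M A - e/2) < emeasure M K"
      by (auto simp: less_SUP_iff)
    then show ?thesis
      using that[of K] False by (auto simp: emeasure_eq_measure ennreal_less_iff)
  qed
  have [measurable]: "U \<in> sets borel" "K \<in> sets borel"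
    using U K by (auto simp: compact_imp_closed)
  obtain \<phi> :: "'a \<Rightarrow> real" where \<phi>: "continuous_on UNIV \<phi>" "\<And>x. \<phi> x \<in> closed_segment 1 0"
    "\<And>x. x \<in> K \<Longrightarrow> \<phi> x = 1" "\<And>x. x \<in> - U \<Longrightarrow> \<phi> x = 0"
    using Urysohn[of K "-U" "1::real" 0] K U by (auto simp: compact_imp_closed)
  have 01: "\<phi> x \<in> {0..1}" for x
    using \<phi>(2)[of x] by (auto simp: closed_segment_eq_real_ivl)
  have [measurable]: "\<phi> \<in> borel_measurable borel"
    using \<phi>(1) by (rule borel_measurable_continuous_onI)
  have "(\<integral>x. \<bar>indicator A x - \<phi> x\<bar> \<partial>M) \<le> (\<integral>x. indicator (U - K) x \<partial>M)"
  proof (rule integral_mono)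
    have "\<bar>indicator A x - \<phi> x\<bar> \<le> 1" for x
      using 01[of x] by (auto simp: indicator_def)
    then show "integrable M (\<lambda>x. \<bar>indicator A x - \<phi> x\<bar>)"
      by (intro integrable_const_bound[of _ 1]) auto
    show "integrable M (indicator (U - K) :: 'a \<Rightarrow> real)"
      by (simp add: less_top[symmetric])
    show "\<bar>indicator A x - \<phi> x\<bar> \<le> indicator (U - K) x" for x
      using 01[of x] \<phi>(3,4)[of x] U(1) K(1) by (auto simp: indicator_def abs_le_iff)
  qed
  also have "\<dots> = measure M U - measure M K"
    using U K by (subst finite_measure_Diff[symmetric]) auto
  also have "\<dots> < e"
    using mU K(3) by simp
  finally show ?thesis
    using that \<phi>(1) 01 by blast
qed

text \<open>The real and imaginary parts of \<open>iexp (t * x)\<close> are bounded and continuous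
  in \<open>x\<close>, so the characteristic functions coincide and Levy's uniqueness theorem
  applies.\<close>

lemma real_distribution_eqI_continuous:
  assumes "real_distribution M" "real_distribution N"
    and "\<And>\<phi> :: real \<Rightarrow> real. continuous_on UNIV \<phi> \<Longrightarrow> bounded (range \<phi>) \<Longrightarrow>
      (\<integral>x. \<phi> x \<partial>M) = (\<integral>x. \<phi> x \<partial>N)"
  shows "M = N"
proof (rule Levy_uniqueness[OF assms(1,2)], rule ext)
  fix t
  interpret M: real_distribution M by fact
  interpret N: real_distribution N by fact
  have iM: "integrable M (\<lambda>x. iexp (t * x))" and iN: "integrable N (\<lambda>x. iexp (t * x))"
    by (auto intro!: M.integrable_iexp N.integrable_iexp)
  have Re: "(\<integral>x. Re (iexp (t * x)) \<partial>M) = (\<integral>x. Re (iexp (t * x)) \<partial>N)"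
    by (rule assms(3)) (auto intro!: continuous_intros boundedI[of _ 1] simp: Re_exp)
  have Im: "(\<integral>x. Im (iexp (t * x)) \<partial>M) = (\<integral>x. Im (iexp (t * x)) \<partial>N)"
    by (rule assms(3)) (auto intro!: continuous_intros boundedI[of _ 1] simp: Im_exp)
  show "char M t = char N t"
    unfolding char_def
    using Re Im integral_Re[OF iM] integral_Re[OF iN] integral_Im[OF iM] integral_Im[OF iN]
    by (simp add: complex_eq_iff)
qed

section \<open>Couplings, their weak limits and the mass of rectangles\<close>

lemma borel_measurable_fst_snd [measurable]:
  "fst \<in> measurable (borel :: ('a::second_countable_topology \<times> 'b::second_countable_topology) measure) borel"
  "snd \<in> measurable (borel :: ('a::second_countable_topology \<times> 'b::second_countable_topology) measure) borel"
  by (auto intro!: borel_measurable_continuous_onI continuous_intros)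

lemma prob_space_Marg:
  assumes "prob_space \<mu>" "\<rho> \<in> Marg \<mu> \<nu>"
  shows "prob_space \<rho>"
proof -
  have "sets \<rho> = sets borel" using assms by (simp add: Marg_def)
  then have "fst \<in> measurable \<rho> borel"
    by (simp cong: measurable_cong_sets)
  moreover have "prob_space (distr \<rho> borel fst)"
    using assms by (simp add: Marg_def)
  ultimately show ?thesis by (rule prob_space_distrD)
qed

text \<open>For a coordinate projection \<open>p\<close> and a test function \<phi>, the integral of
  \<open>\<phi> (p z)\<close> against \<open>g x\<close> is eventually constant, being an integral
  against a fixed marginal. Its limit is the integral against \<open>l\<close>, so \<open>l\<close>
  has the same marginals. This makes estimates uniform over couplings available at the limit
  too.\<close>

lemma Marg_limitin:
  assumes \<mu>: "real_distribution \<mu>" and \<nu>: "real_distribution \<nu>" and "G \<noteq> bot"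
    and g: "\<forall>\<^sub>F x in G. g x \<in> Marg \<mu> \<nu>" and lim: "limitin weak_topology g l G"
  shows "l \<in> Marg \<mu> \<nu>"
proof -
  have setsl: "sets l = sets borel" and "finite_measure l"
    using limitin_topspace[OF lim] by (auto simp: topspace_weak_topology)
  note [measurable_cong] = setsl
  note int = limitin_weak_topology_imp_tendsto_integral[OF lim]
  interpret l: finite_measure l by fact
  interpret \<mu>: real_distribution \<mu> by fact
  have spl: "space l = UNIV" using sets_eq_imp_space_eq[OF setsl] by simp
  \<comment> \<open>The test function 1 shows that \<open>l\<close> has mass one, so that its images
    on the line are real distributions.\<close>
  have "((\<lambda>x. \<integral>z. 1 \<partial>g x) \<longlongrightarrow> (\<integral>z. (1::real) \<partial>l)) G"
    by (rule int) auto
  moreover have "\<forall>\<^sub>F x in G. (\<integral>z. 1 \<partial>g x) = (1::real)"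
    using g by eventually_elim
      (use prob_space_Marg[OF \<mu>.prob_space_axioms] prob_space.prob_space in fastforce)
  ultimately have "((\<lambda>x. 1) \<longlongrightarrow> (\<integral>z. (1::real) \<partial>l)) G"
    by (rule Lim_transform_eventually)
  then have "(\<integral>z. (1::real) \<partial>l) = 1"
    using tendsto_unique[OF \<open>G \<noteq> bot\<close> _ tendsto_const] by blast
  then have "measure l (space l) = 1"
    by simp
  then have l: "prob_space l"
    by (intro prob_spaceI) (simp add: l.emeasure_eq_measure)
  \<comment> \<open>Stated for a continuous \<open>p\<close> in order to treat both projections at
    once.\<close>
  have *: "distr l borel p = \<kappa>"
    if \<kappa>: "real_distribution \<kappa>" and p: "continuous_on UNIV p"
      and gp: "\<forall>\<^sub>F x in G. sets (g x) = sets borel \<and> distr (g x) borel p = \<kappa>"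
    for \<kappa> :: "real measure" and p :: "real \<times> real \<Rightarrow> real"
  proof (rule real_distribution_eqI_continuous[OF _ \<kappa>])
    have [measurable]: "p \<in> borel_measurable borel"
      using p by (rule borel_measurable_continuous_onI)
    have "p \<in> measurable l borel" by measurable
    then show "real_distribution (distr l borel p)"
      using l by (simp add: prob_space.real_distribution_distr)
    fix \<phi> :: "real \<Rightarrow> real" assume \<phi>: "continuous_on UNIV \<phi>" "bounded (range \<phi>)"
    have [measurable]: "\<phi> \<in> borel_measurable borel"
      using \<phi>(1) by (rule borel_measurable_continuous_onI)
    have "((\<lambda>x. \<integral>z. \<phi> (p z) \<partial>g x) \<longlongrightarrow> (\<integral>z. \<phi> (p z) \<partial>l)) G"
      using \<phi> p by (intro int continuous_on_compose2[OF \<phi>(1)]) (auto intro: bounded_subset)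
    moreover have "\<forall>\<^sub>F x in G. (\<integral>z. \<phi> (p z) \<partial>g x) = (\<integral>z. \<phi> z \<partial>\<kappa>)"
      using gp
    proof eventually_elim
      case (elim x)
      then have [measurable_cong]: "sets (g x) = sets borel" by simp
      have "p \<in> measurable (g x) borel" by measurable
      then have "(\<integral>z. \<phi> z \<partial>distr (g x) borel p) = (\<integral>z. \<phi> (p z) \<partial>g x)"
        by (rule integral_distr) measurable
      then show ?case using elim by simp
    qed
    ultimately have "((\<lambda>x. \<integral>z. \<phi> z \<partial>\<kappa>) \<longlongrightarrow> (\<integral>z. \<phi> (p z) \<partial>l)) G"
      by (rule Lim_transform_eventually)
    then have "(\<integral>z. \<phi> (p z) \<partial>l) = (\<integral>z. \<phi> z \<partial>\<kappa>)"
      using tendsto_unique[OF \<open>G \<noteq> bot\<close> _ tendsto_const] by blast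
    moreover have "(\<integral>z. \<phi> z \<partial>distr l borel p) = (\<integral>z. \<phi> (p z) \<partial>l)"
      by (rule integral_distr) measurable
    ultimately show "(\<integral>z. \<phi> z \<partial>distr l borel p) = (\<integral>z. \<phi> z \<partial>\<kappa>)" by simp
  qed
  have "distr l borel fst = \<mu>"
    using g by (intro * \<mu>) (auto simp: Marg_def intro!: continuous_intros elim: eventually_mono)
  moreover have "distr l borel snd = \<nu>"
    using g by (intro * \<nu>) (auto simp: Marg_def intro!: continuous_intros elim: eventually_mono)
  ultimately show ?thesis using setsl by (simp add: Marg_def)
qed

text \<open>The error of replacing a product of indicators by
  \<open>\<phi> (fst z) * \<psi> (snd z)\<close> splits into two terms that each depend on a single
  coordinate. Their integrals are therefore integrals against the marginals, which makes the bound
  the same for every coupling.\<close>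

lemma measure_Times_approx:
  fixes \<phi> \<psi> :: "real \<Rightarrow> real"
  assumes "real_distribution \<mu>" "\<rho> \<in> Marg \<mu> \<nu>"
    and [measurable]: "A \<in> sets borel" "B \<in> sets borel"
      "\<phi> \<in> borel_measurable borel" "\<psi> \<in> borel_measurable borel"
    and \<phi>: "\<And>x. \<phi> x \<in> {0..1}" and \<psi>: "\<And>x. \<psi> x \<in> {0..1}"
  shows "\<bar>measure \<rho> (A \<times> B) - (\<integral>z. \<phi> (fst z) * \<psi> (snd z) \<partial>\<rho>)\<bar> \<le>
    (\<integral>x. \<bar>indicator A x - \<phi> x\<bar> \<partial>\<mu>) + (\<integral>y. \<bar>indicator B y - \<psi> y\<bar> \<partial>\<nu>)"
proof -
  interpret \<mu>: real_distribution \<mu> by fact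
  interpret \<rho>: prob_space \<rho> using prob_space_Marg[OF \<mu>.prob_space_axioms assms(2)] .
  have sets\<rho>[measurable_cong]: "sets \<rho> = sets borel" and m: "distr \<rho> borel fst = \<mu>" "distr \<rho> borel snd = \<nu>"
    using assms(2) by (auto simp: Marg_def)
  have bd: "\<bar>a - b\<bar> \<le> 1" if "a \<in> {0..1}" "b \<in> {0..1}" for a b :: real
    using that by (auto simp: abs_le_iff)
  have ind: "indicator S x \<in> {0..1::real}" for S :: "real set" and x
    by (auto simp: indicator_def)
  have prod_bd: "a * b \<in> {0..1}" if "a \<in> {0..1}" "b \<in> {0..1}" for a b :: real
    using that by (auto simp: mult_le_one)
  have ind2: "indicator (A \<times> B) z = (indicator A (fst z) * indicator B (snd z) :: real)" for z
    by (cases z) (auto simp: indicator_def)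
  have i1: "integrable \<rho> (\<lambda>z. indicator A (fst z) * indicator B (snd z) :: real)"
    using prod_bd[OF ind ind] by (intro \<rho>.integrable_const_bound[of _ 1]) auto
  have i2: "integrable \<rho> (\<lambda>z. \<phi> (fst z) * \<psi> (snd z))"
    using prod_bd[OF \<phi> \<psi>] by (intro \<rho>.integrable_const_bound[of _ 1]) auto
  have i3: "integrable \<rho> (\<lambda>z. \<bar>indicator A (fst z) - \<phi> (fst z)\<bar>)"
    using bd[OF ind \<phi>] by (intro \<rho>.integrable_const_bound[of _ 1]) auto
  have i4: "integrable \<rho> (\<lambda>z. \<bar>indicator B (snd z) - \<psi> (snd z)\<bar>)"
    using bd[OF ind \<psi>] by (intro \<rho>.integrable_const_bound[of _ 1]) auto
  have "measure \<rho> (A \<times> B) = (\<integral>z. indicator A (fst z) * indicator B (snd z) \<partial>\<rho>)"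
    unfolding ind2[symmetric] using sets_eq_imp_space_eq[OF sets\<rho>] by simp
  then have "\<bar>measure \<rho> (A \<times> B) - (\<integral>z. \<phi> (fst z) * \<psi> (snd z) \<partial>\<rho>)\<bar> =
      \<bar>\<integral>z. indicator A (fst z) * indicator B (snd z) - \<phi> (fst z) * \<psi> (snd z) \<partial>\<rho>\<bar>"
    using i1 i2 by simp
  also have "\<dots> \<le> (\<integral>z. \<bar>indicator A (fst z) * indicator B (snd z) - \<phi> (fst z) * \<psi> (snd z)\<bar> \<partial>\<rho>)"
    by (rule integral_abs_bound)
  also have "\<dots> \<le> (\<integral>z. \<bar>indicator A (fst z) - \<phi> (fst z)\<bar> + \<bar>indicator B (snd z) - \<psi> (snd z)\<bar> \<partial>\<rho>)"
  proof (rule integral_mono)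
    fix z
    \<comment> \<open>Telescoping through \<open>a * d\<close> leaves the factors \<open>a\<close>
      and \<open>d\<close>, which lie between 0 and 1, in front of the two differences.\<close>
    have "\<bar>a * b - c * d\<bar> \<le> \<bar>a - c\<bar> + \<bar>b - d\<bar>" if "a \<in> {0..1}" "d \<in> {0..1}" for a b c d :: real
    proof -
      have "\<bar>a * b - c * d\<bar> = \<bar>a * (b - d) + d * (a - c)\<bar>" by (simp add: algebra_simps)
      also have "\<dots> \<le> a * \<bar>b - d\<bar> + d * \<bar>a - c\<bar>"
        using that abs_triangle_ineq[of "a * (b - d)" "d * (a - c)"] by (simp add: abs_mult)
      also have "\<dots> \<le> 1 * \<bar>b - d\<bar> + 1 * \<bar>a - c\<bar>"
        using that by (intro add_mono mult_right_mono) auto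
      finally show ?thesis by simp
    qed
    then show "\<bar>indicator A (fst z) * indicator B (snd z) - \<phi> (fst z) * \<psi> (snd z)\<bar> \<le>
        \<bar>indicator A (fst z) - \<phi> (fst z)\<bar> + \<bar>indicator B (snd z) - \<psi> (snd z)\<bar>"
      using ind \<psi> by blast
  qed (use i1 i2 i3 i4 in auto)
  also have "\<dots> = (\<integral>z. \<bar>indicator A (fst z) - \<phi> (fst z)\<bar> \<partial>\<rho>) + (\<integral>z. \<bar>indicator B (snd z) - \<psi> (snd z)\<bar> \<partial>\<rho>)"
    using i3 i4 by simp
  also have "(\<integral>z. \<bar>indicator A (fst z) - \<phi> (fst z)\<bar> \<partial>\<rho>) = (\<integral>x. \<bar>indicator A x - \<phi> x\<bar> \<partial>\<mu>)"
    unfolding m(1)[symmetric] by (subst integral_distr) auto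
  also have "(\<integral>z. \<bar>indicator B (snd z) - \<psi> (snd z)\<bar> \<partial>\<rho>) = (\<integral>y. \<bar>indicator B y - \<psi> y\<bar> \<partial>\<nu>)"
    unfolding m(2)[symmetric] by (subst integral_distr) auto
  finally show ?thesis .
qed

text \<open>Since the marginals are fixed, one continuous approximation of the indicators in
  \<open>L\<^sup>1(\<mu>)\<close> and \<open>L\<^sup>1(\<nu>)\<close> serves all couplings at once; no continuity condition on the
  boundary of the rectangle is needed.\<close>

lemma tendsto_measure_Times:
  assumes \<mu>: "real_distribution \<mu>" and \<nu>: "real_distribution \<nu>" and "G \<noteq> bot"
    and g: "\<forall>\<^sub>F x in G. g x \<in> Marg \<mu> \<nu>" and lim: "limitin weak_topology g l G"
    and A: "A \<in> sets borel" and B: "B \<in> sets borel"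
  shows "((\<lambda>x. measure (g x) (A \<times> B)) \<longlongrightarrow> measure l (A \<times> B)) G"
proof (rule tendstoI)
  fix e :: real assume "0 < e"
  interpret \<mu>: real_distribution \<mu> by fact
  interpret \<nu>: real_distribution \<nu> by fact
  \<comment> \<open>Five errors of size \<open>e/5\<close> will add up: two marginal errors for
    \<open>g x\<close>, two for \<open>l\<close>, and one from the convergence of the continuous
    integrals.\<close>
  obtain \<phi> where \<phi>: "continuous_on UNIV \<phi>" "\<And>x. \<phi> x \<in> {0..1}"
    "(\<integral>x. \<bar>indicator A x - \<phi> x\<bar> \<partial>\<mu>) < e/5"
    using indicator_approx_continuous[of \<mu> A "e/5"] A \<open>0 < e\<close> \<mu>.finite_measure_axioms by auto
  obtain \<psi> where \<psi>: "continuous_on UNIV \<psi>" "\<And>x. \<psi> x \<in> {0..1}"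
    "(\<integral>x. \<bar>indicator B x - \<psi> x\<bar> \<partial>\<nu>) < e/5"
    using indicator_approx_continuous[of \<nu> B "e/5"] B \<open>0 < e\<close> \<nu>.finite_measure_axioms by auto
  let ?I = "\<lambda>\<rho>. \<integral>z. \<phi> (fst z) * \<psi> (snd z) \<partial>\<rho>"
  have approx: "\<bar>measure \<rho> (A \<times> B) - ?I \<rho>\<bar> < 2 * e/5" if "\<rho> \<in> Marg \<mu> \<nu>" for \<rho>
    using measure_Times_approx[OF \<mu> that A B borel_measurable_continuous_onI[OF \<phi>(1)]
        borel_measurable_continuous_onI[OF \<psi>(1)] \<phi>(2) \<psi>(2)] \<phi>(3) \<psi>(3)
    by simp
  have "((\<lambda>x. ?I (g x)) \<longlongrightarrow> ?I l) G"
  proof (rule limitin_weak_topology_imp_tendsto_integral[OF lim])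
    show "continuous_on UNIV (\<lambda>z. \<phi> (fst z) * \<psi> (snd z))"
      by (intro continuous_intros continuous_on_compose2[OF \<phi>(1)] continuous_on_compose2[OF \<psi>(1)]) auto
    have "\<bar>\<phi> x * \<psi> y\<bar> \<le> 1" for x y
      using \<phi>(2)[of x] \<psi>(2)[of y] by (auto simp: abs_mult mult_le_one)
    then show "bounded (range (\<lambda>z. \<phi> (fst z) * \<psi> (snd z)))"
      by (intro boundedI[of _ 1]) auto
  qed
  then have "\<forall>\<^sub>F x in G. dist (?I (g x)) (?I l) < e/5"
    by (rule tendstoD) (use \<open>0 < e\<close> in simp)
  then show "\<forall>\<^sub>F x in G. dist (measure (g x) (A \<times> B)) (measure l (A \<times> B)) < e"
    using g
  proof eventually_elim
    case (elim x)
    show ?case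
      using elim(1) approx[OF elim(2)] approx[OF Marg_limitin[OF \<mu> \<nu> \<open>G \<noteq> bot\<close> g lim]]
      unfolding dist_real_def by linarith
  qed
qed

section \<open>Rank one structure of the density\<close>

text \<open>When the two ways of pairing two sources with two targets cost the same, the exponential
  weights on both sides of the cyclic identity agree and can be cancelled.\<close>

lemma cyclically_invariant_cross:
  assumes "cyclically_invariant \<epsilon> \<mu> \<nu> \<rho>"
  obtains f :: "real \<times> real \<Rightarrow> real" where "f \<in> borel_measurable borel" "\<And>z. 0 \<le> f z"
    "\<rho> = density (\<mu> \<Otimes>\<^sub>M \<nu>) (\<lambda>z. ennreal (f z))"
    "\<And>x x' y y'. \<bar>y - x\<bar> + \<bar>y' - x'\<bar> = \<bar>y' - x\<bar> + \<bar>y - x'\<bar> \<Longrightarrow>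
      f (x, y) * f (x', y') = f (x, y') * f (x', y)"
proof -
  obtain f :: "real \<times> real \<Rightarrow> real" where f: "f \<in> borel_measurable borel" "\<And>z. 0 \<le> f z"
    "\<rho> = density (\<mu> \<Otimes>\<^sub>M \<nu>) (\<lambda>z. ennreal (f z))"
    and cyc: "\<And>n x y. n \<ge> 1 \<Longrightarrow>
      (\<Prod>i<n. exp (\<bar>y i - x i\<bar> / \<epsilon>) * f (x i, y i)) =
      (\<Prod>i<n. exp (\<bar>y (Suc i mod n) - x i\<bar> / \<epsilon>) * f (x i, y (Suc i mod n)))"
    using assms unfolding cyclically_invariant_def by blast
  have "f (x, y) * f (x', y') = f (x, y') * f (x', y)"
    if eq: "\<bar>y - x\<bar> + \<bar>y' - x'\<bar> = \<bar>y' - x\<bar> + \<bar>y - x'\<bar>" for x x' y y'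
  proof -
    \<comment> \<open>With \<open>n = 2\<close> the cyclic successor swaps the indices 0 and 1, so
      the right-hand product pairs \<open>x\<close> with \<open>y'\<close> and \<open>x'\<close>
      with \<open>y\<close>.\<close>
    have "exp (\<bar>y - x\<bar> / \<epsilon>) * f (x, y) * (exp (\<bar>y' - x'\<bar> / \<epsilon>) * f (x', y')) =
        exp (\<bar>y' - x\<bar> / \<epsilon>) * f (x, y') * (exp (\<bar>y - x'\<bar> / \<epsilon>) * f (x', y))"
      using cyc[of 2 "\<lambda>i. if i = 0 then y else y'" "\<lambda>i. if i = 0 then x else x'"]
      by (simp add: numeral_2_eq_2 mult_ac)
    then have "exp ((\<bar>y - x\<bar> + \<bar>y' - x'\<bar>) / \<epsilon>) * (f (x, y) * f (x', y')) =
        exp ((\<bar>y' - x\<bar> + \<bar>y - x'\<bar>) / \<epsilon>) * (f (x, y') * f (x', y))"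
      by (simp add: add_divide_distrib exp_add mult_ac)
    then show ?thesis using eq by simp
  qed
  then show ?thesis using that f by blast
qed

text \<open>If all 2 by 2 minors of \<open>f\<close> vanish on \<open>B1 \<times> B2\<close> and
  \<open>f (x0, y0)\<close> is nonzero, then
  \<open>f (x, y) = f (x, y0) / f (x0, y0) * f (x0, y)\<close> there. By Tonelli the mass of a
  subrectangle factors as \<open>a C1 * b C2\<close>, and both sides of the claim are the same
  product of four factors.\<close>

lemma density_rank_one_cross:
  fixes f :: "'a \<times> 'b \<Rightarrow> real"
  assumes "sigma_finite_measure \<nu>"
    and f[measurable]: "f \<in> borel_measurable (\<mu> \<Otimes>\<^sub>M \<nu>)" and nn: "\<And>z. 0 \<le> f z"
    and cross: "\<And>x x' y y'. x \<in> B1 \<Longrightarrow> x' \<in> B1 \<Longrightarrow> y \<in> B2 \<Longrightarrow> y' \<in> B2 \<Longrightarrow>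
      f (x, y) * f (x', y') = f (x, y') * f (x', y)"
    and B[measurable]: "B1 \<in> sets \<mu>" "B2 \<in> sets \<nu>"
    and A[measurable]: "A1 \<in> sets \<mu>" "A2 \<in> sets \<nu>" and sub: "A1 \<subseteq> B1" "A2 \<subseteq> B2"
  defines "\<rho> \<equiv> density (\<mu> \<Otimes>\<^sub>M \<nu>) (\<lambda>z. ennreal (f z))"
  shows "measure \<rho> (A1 \<times> A2) * measure \<rho> (B1 \<times> B2) =
    measure \<rho> (A1 \<times> B2) * measure \<rho> (B1 \<times> A2)"
proof -
  interpret \<nu>: sigma_finite_measure \<nu> by fact
  have em: "emeasure \<rho> (C1 \<times> C2) =
      (\<integral>\<^sup>+x. \<integral>\<^sup>+y. ennreal (f (x, y)) * indicator (C1 \<times> C2) (x, y) \<partial>\<nu> \<partial>\<mu>)"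
    if [measurable]: "C1 \<in> sets \<mu>" "C2 \<in> sets \<nu>" for C1 C2
  proof -
    have "emeasure \<rho> (C1 \<times> C2) =
        (\<integral>\<^sup>+z. ennreal (f z) * indicator (C1 \<times> C2) z \<partial>(\<mu> \<Otimes>\<^sub>M \<nu>))"
      unfolding \<rho>_def by (rule emeasure_density) measurable
    also have "\<dots> = (\<integral>\<^sup>+x. \<integral>\<^sup>+y. ennreal (f (x, y)) * indicator (C1 \<times> C2) (x, y) \<partial>\<nu> \<partial>\<mu>)"
      by (rule \<nu>.nn_integral_fst[symmetric]) measurable
    finally show ?thesis .
  qed
  show ?thesis
  proof (cases "\<exists>x0\<in>B1. \<exists>y0\<in>B2. f (x0, y0) \<noteq> 0")
    case True
    then obtain x0 y0 where 0: "x0 \<in> B1" "y0 \<in> B2" "f (x0, y0) \<noteq> 0" by blast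
    then have "x0 \<in> space \<mu>" "y0 \<in> space \<nu>"
      using sets.sets_into_space B by blast+
    then have [measurable]: "(\<lambda>x. f (x, y0)) \<in> borel_measurable \<mu>" "(\<lambda>y. f (x0, y)) \<in> borel_measurable \<nu>"
      by measurable
    define a where "a C = (\<integral>\<^sup>+x. ennreal (f (x, y0) / f (x0, y0)) * indicator C x \<partial>\<mu>)" for C
    define b where "b C = (\<integral>\<^sup>+y. ennreal (f (x0, y)) * indicator C y \<partial>\<nu>)" for C
    have ab: "emeasure \<rho> (C1 \<times> C2) = a C1 * b C2"
      if [measurable]: "C1 \<in> sets \<mu>" "C2 \<in> sets \<nu>" and C: "C1 \<subseteq> B1" "C2 \<subseteq> B2" for C1 C2
    proof -
      have "ennreal (f (x, y)) * indicator (C1 \<times> C2) (x, y) =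
          ennreal (f (x, y0) / f (x0, y0)) * indicator C1 x * (ennreal (f (x0, y)) * indicator C2 y)" for x y
      proof (cases "x \<in> C1 \<and> y \<in> C2")
        case True
        then have "f (x, y) = f (x, y0) / f (x0, y0) * f (x0, y)"
          using cross[of x x0 y y0] 0 C by (auto simp: field_simps)
        then show ?thesis
          using True nn by (simp del: times_divide_eq_left add: ennreal_mult[symmetric])
      qed (auto simp: indicator_def)
      then have "emeasure \<rho> (C1 \<times> C2) =
          (\<integral>\<^sup>+x. \<integral>\<^sup>+y. ennreal (f (x, y0) / f (x0, y0)) * indicator C1 x * (ennreal (f (x0, y)) * indicator C2 y) \<partial>\<nu> \<partial>\<mu>)"
        using em that by simp
      also have "\<dots> = (\<integral>\<^sup>+x. ennreal (f (x, y0) / f (x0, y0)) * indicator C1 x * b C2 \<partial>\<mu>)"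
        unfolding b_def by (intro nn_integral_cong nn_integral_cmult) measurable
      also have "\<dots> = a C1 * b C2"
        unfolding a_def by (rule nn_integral_multc) measurable
      finally show ?thesis .
    qed
    \<comment> \<open>\<open>enn2real\<close> is multiplicative even at infinity, which it sends to
      0, so the factorization carries over to \<open>measure\<close> whether or not \<open>a\<close>
      and \<open>b\<close> are finite.\<close>
    show ?thesis
      using sub by (simp add: measure_def ab B A enn2real_mult mult_ac)
  next
    \<comment> \<open>The density vanishes on the whole rectangle, so \<open>B1 \<times> B2\<close>
      and \<open>A1 \<times> B2\<close> are null and each side has a zero factor.\<close>
    case False
    then have zero: "ennreal (f (x, y)) * indicator (B1 \<times> B2) (x, y) = 0" for x y
      by (auto simp: indicator_def)
    have "emeasure \<rho> (B1 \<times> B2) = 0"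
      unfolding em[OF B] zero by simp
    moreover have "emeasure \<rho> (A1 \<times> B2) \<le> emeasure \<rho> (B1 \<times> B2)"
      using sub by (intro emeasure_mono) (auto simp: \<rho>_def)
    ultimately show ?thesis by (simp add: measure_def)
  qed
qed

section \<open>Product measures and restricted Borel spaces\<close>

text \<open>The factors are the two marginals, the second divided by the total mass. The cross
  identity says that their product agrees with \<rho> on measurable rectangles, which determine a
  product of sigma-finite measures.\<close>

lemma is_product_measureI:
  assumes "finite_measure \<rho>" and sets_\<rho>: "sets \<rho> = sets (M \<Otimes>\<^sub>M N)"
    and cross: "\<And>A B. A \<in> sets M \<Longrightarrow> B \<in> sets N \<Longrightarrow>
      measure \<rho> (A \<times> B) * measure \<rho> (space \<rho>) =
      measure \<rho> (A \<times> space N) * measure \<rho> (space M \<times> B)"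
  shows "is_product_measure \<rho>"
proof -
  interpret finite_measure \<rho> by fact
  note [measurable_cong] = sets_\<rho>
  have sp: "space \<rho> = space M \<times> space N"
    using sets_eq_imp_space_eq[OF sets_\<rho>] by (simp add: space_pair_measure)
  define \<alpha> where "\<alpha> = distr \<rho> M fst"
  \<comment> \<open>If \<rho> has mass 0, then \<open>inverse 0 = 0\<close> makes \<beta> the null
    measure, and the product is still \<rho>.\<close>
  define \<beta> where "\<beta> = scale_measure (ennreal (inverse (measure \<rho> (space \<rho>)))) (distr \<rho> N snd)"
  have \<alpha>: "emeasure \<alpha> A = ennreal (measure \<rho> (A \<times> space N))" if "A \<in> sets M" for A
  proof -
    have "fst -` A \<inter> space \<rho> = A \<times> space N"
      using sets.sets_into_space[OF that] by (auto simp: sp)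
    then show ?thesis
      using that by (simp add: \<alpha>_def emeasure_distr emeasure_eq_measure)
  qed
  have \<beta>: "emeasure \<beta> B = ennreal (measure \<rho> (space M \<times> B) / measure \<rho> (space \<rho>))" if "B \<in> sets N" for B
  proof -
    have "snd -` B \<inter> space \<rho> = space M \<times> B"
      using sets.sets_into_space[OF that] by (auto simp: sp)
    then show ?thesis
      using that by (simp add: \<beta>_def emeasure_distr emeasure_eq_measure divide_inverse mult.commute flip: ennreal_mult)
  qed
  have fin: "finite_measure \<alpha>" "finite_measure \<beta>"
    using \<alpha>[of "space M"] \<beta>[of "space N"]
    by (auto intro!: finite_measureI simp: \<alpha>_def \<beta>_def space_scale_measure)
  have "\<alpha> \<Otimes>\<^sub>M \<beta> = \<rho>"
  proof (rule pair_measure_eqI)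
    show "sigma_finite_measure \<alpha>" "sigma_finite_measure \<beta>"
      using fin by (auto simp: finite_measure_def)
    show "sets (\<alpha> \<Otimes>\<^sub>M \<beta>) = sets \<rho>"
      unfolding sets_\<rho> by (rule sets_pair_measure_cong) (auto simp: \<alpha>_def \<beta>_def)
    fix A B assume "A \<in> sets \<alpha>" "B \<in> sets \<beta>"
    then have AB: "A \<in> sets M" "B \<in> sets N" by (auto simp: \<alpha>_def \<beta>_def)
    have "measure \<rho> (A \<times> space N) * (measure \<rho> (space M \<times> B) / measure \<rho> (space \<rho>)) = measure \<rho> (A \<times> B)"
    proof (cases "measure \<rho> (space \<rho>) = 0")
      case True
      then show ?thesis
        using bounded_measure[of "A \<times> B"] measure_nonneg[of \<rho> "A \<times> B"] by simp
    next
      case False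
      then show ?thesis using cross[OF AB] by (simp add: field_simps)
    qed
    then show "emeasure \<alpha> A * emeasure \<beta> B = emeasure \<rho> (A \<times> B)"
      using AB by (simp add: \<alpha> \<beta> emeasure_eq_measure flip: ennreal_mult)
  qed
  then show ?thesis using fin unfolding is_product_measure_def by metis
qed

text \<open>An equation between measures includes their sigma-algebras, so the restriction must be
  seen to carry a product one. Both spaces have underlying set \<open>B1 \<times> B2\<close>, and
  each inclusion is the measurability of the identity map in one direction.\<close>

lemma sets_restrict_space_pair_borel:
  fixes B1 :: "'a::second_countable_topology set" and B2 :: "'b::second_countable_topology set"
  assumes B: "B1 \<in> sets borel" "B2 \<in> sets borel"
  shows "sets (restrict_space borel (B1 \<times> B2)) =
    sets (restrict_space borel B1 \<Otimes>\<^sub>M restrict_space borel B2)" (is "sets ?L = sets ?R")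
proof (rule antisym)
  have sp: "space ?R = B1 \<times> B2"
    by (simp add: space_pair_measure space_restrict_space)
  have "(\<lambda>z. z) \<in> measurable ?R (borel :: ('a \<times> 'b) measure)"
    unfolding borel_prod[symmetric]
    by (rule measurable_Pair[of fst _ _ snd, simplified])
       (auto intro!: measurable_compose[OF measurable_fst] measurable_compose[OF measurable_snd]
         measurable_restrict_space1)
  then have "(\<lambda>z. z) \<in> measurable ?R ?L"
    by (rule measurable_restrict_space2[rotated]) (auto simp: sp)
  from measurable_sets[OF this] show "sets ?L \<subseteq> sets ?R"
    using sets.sets_into_space by (fastforce simp: sp space_restrict_space Int_absorb2)
  have "fst \<in> measurable ?L (restrict_space borel B1)" "snd \<in> measurable ?L (restrict_space borel B2)"
    by (intro measurable_restrict_space2 measurable_restrict_space1 borel_measurable_fst_snd;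
        force simp: space_restrict_space)+
  then have "(\<lambda>z. z) \<in> measurable ?L ?R"
    by (rule measurable_Pair[of fst _ _ snd, simplified])
  from measurable_sets[OF this] show "sets ?R \<subseteq> sets ?L"
    using sets.sets_into_space by (fastforce simp: sp space_restrict_space Int_absorb2)
qed

section \<open>Passage to the limit on a rectangle on one side of the diagonal\<close>

theorem theorem3:
  fixes \<mu> \<nu> :: "real measure"
    and \<pi> :: "real \<Rightarrow> (real \<times> real) measure"
    and \<pi>' :: "(real \<times> real) measure"
    and B1 B2 :: "real set"
  assumes "real_distribution \<mu>" and "real_distribution \<nu>"
    and "\<And>\<epsilon>. \<epsilon> > 0 \<Longrightarrow> cyclically_invariant \<epsilon> \<mu> \<nu> (\<pi> \<epsilon>)"
    and "cluster_point weak_topology \<pi> (at_right 0) \<pi>'"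
    and "B1 \<in> sets borel" and "B2 \<in> sets borel"
    and "B1 \<times> B2 \<subseteq> {(x, y). x \<le> y} \<or> B1 \<times> B2 \<subseteq> {(x, y). x \<ge> y}"
  shows "is_product_measure (restrict_space \<pi>' (B1 \<times> B2))"
proof -
  interpret \<mu>: real_distribution \<mu> by fact
  interpret \<nu>: real_distribution \<nu> by fact
  note B = \<open>B1 \<in> sets borel\<close> \<open>B2 \<in> sets borel\<close>
  obtain G where G: "G \<noteq> bot" "G \<le> at_right 0" and lim: "limitin weak_topology \<pi> \<pi>' G"
    using assms(4) by (rule cluster_point_imp_limitin)
  have pos: "\<forall>\<^sub>F \<epsilon> in G. 0 < \<epsilon>"
    using G(2) by (rule filter_leD) (simp add: eventually_at_right_less)
  then have marg: "\<forall>\<^sub>F \<epsilon> in G. \<pi> \<epsilon> \<in> Marg \<mu> \<nu>"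
    by eventually_elim (use assms(3) in \<open>auto simp: cyclically_invariant_def\<close>)
  note tendsto = tendsto_measure_Times[OF assms(1,2) G(1) marg lim]
  \<comment> \<open>All points of \<open>B1\<close> lie on the same side of all points of
    \<open>B2\<close>, so the absolute values open with one common sign and both sums are
    \<open>y + y' - x - x'\<close> up to that sign.\<close>
  have cost: "\<bar>y - x\<bar> + \<bar>y' - x'\<bar> = \<bar>y' - x\<bar> + \<bar>y - x'\<bar>"
    if "x \<in> B1" "x' \<in> B1" "y \<in> B2" "y' \<in> B2" for x x' y y'
  proof -
    have "(x \<le> y \<and> x \<le> y' \<and> x' \<le> y \<and> x' \<le> y') \<or> (x \<ge> y \<and> x \<ge> y' \<and> x' \<ge> y \<and> x' \<ge> y')"
      using assms(7) that by blast
    then show ?thesis by auto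
  qed
  have cross: "measure \<pi>' (A1 \<times> A2) * measure \<pi>' (B1 \<times> B2) =
      measure \<pi>' (A1 \<times> B2) * measure \<pi>' (B1 \<times> A2)"
    if A: "A1 \<in> sets borel" "A2 \<in> sets borel" "A1 \<subseteq> B1" "A2 \<subseteq> B2" for A1 A2
  \<comment> \<open>The right-hand products for \<open>\<pi> \<epsilon>\<close> tend to the right
    side. They eventually equal the left-hand products, so they also tend to the left side.\<close>
  proof (rule tendsto_unique[OF G(1)])
    let ?L = "\<lambda>\<rho>. measure \<rho> (A1 \<times> A2) * measure \<rho> (B1 \<times> B2)"
    show "((\<lambda>\<epsilon>. measure (\<pi> \<epsilon>) (A1 \<times> B2) * measure (\<pi> \<epsilon>) (B1 \<times> A2)) \<longlongrightarrow>
        measure \<pi>' (A1 \<times> B2) * measure \<pi>' (B1 \<times> A2)) G"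
      using A B by (intro tendsto_mult tendsto)
    have "((\<lambda>\<epsilon>. ?L (\<pi> \<epsilon>)) \<longlongrightarrow> ?L \<pi>') G"
      using A B by (intro tendsto_mult tendsto)
    moreover have "\<forall>\<^sub>F \<epsilon> in G. ?L (\<pi> \<epsilon>) = measure (\<pi> \<epsilon>) (A1 \<times> B2) * measure (\<pi> \<epsilon>) (B1 \<times> A2)"
      using pos
    proof eventually_elim
      case (elim \<epsilon>)
      obtain f where f: "f \<in> borel_measurable borel" "\<And>z. 0 \<le> f z"
        "\<pi> \<epsilon> = density (\<mu> \<Otimes>\<^sub>M \<nu>) (\<lambda>z. ennreal (f z))"
        "\<And>x x' y y'. \<bar>y - x\<bar> + \<bar>y' - x'\<bar> = \<bar>y' - x\<bar> + \<bar>y - x'\<bar> \<Longrightarrow>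
          f (x, y) * f (x', y') = f (x, y') * f (x', y)"
        using cyclically_invariant_cross[OF assms(3)[OF elim]] by blast
      have "sets (\<mu> \<Otimes>\<^sub>M \<nu>) = sets borel"
        unfolding borel_prod[symmetric] by (rule sets_pair_measure_cong) auto
      then have "f \<in> borel_measurable (\<mu> \<Otimes>\<^sub>M \<nu>)"
        using f(1) by (simp cong: measurable_cong_sets)
      then show ?case
        unfolding f(3) using A B f(2) f(4)[OF cost]
        by (intro density_rank_one_cross \<nu>.sigma_finite_measure_axioms) auto
    qed
    ultimately show "((\<lambda>\<epsilon>. measure (\<pi> \<epsilon>) (A1 \<times> B2) * measure (\<pi> \<epsilon>) (B1 \<times> A2)) \<longlongrightarrow> ?L \<pi>') G"
      by (rule Lim_transform_eventually)
  qed
  have sets': "sets \<pi>' = sets borel" and fin: "finite_measure \<pi>'"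
    using limitin_topspace[OF lim] by (auto simp: topspace_weak_topology)
  have BB: "B1 \<times> B2 \<in> sets \<pi>'"
    using B by (simp add: sets' borel_Times)
  have "space \<pi>' = UNIV"
    using sets_eq_imp_space_eq[OF sets'] by simp
  then have space: "space (restrict_space \<pi>' (B1 \<times> B2)) = B1 \<times> B2"
    by (simp add: space_restrict_space)
  show ?thesis
  proof (rule is_product_measureI[of _ "restrict_space borel B1" "restrict_space borel B2"])
    show "finite_measure (restrict_space \<pi>' (B1 \<times> B2))"
      using fin BB by (intro finite_measure_restrict_space) auto
    show "sets (restrict_space \<pi>' (B1 \<times> B2)) =
        sets (restrict_space borel B1 \<Otimes>\<^sub>M restrict_space borel B2)"
      using sets_restrict_space_pair_borel[OF B] sets_restrict_space_cong[OF sets'] by simp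
    fix A1 A2 assume "A1 \<in> sets (restrict_space borel B1)" "A2 \<in> sets (restrict_space borel B2)"
    then have A: "A1 \<in> sets borel" "A2 \<in> sets borel" "A1 \<subseteq> B1" "A2 \<subseteq> B2"
      using B by (auto simp: sets_restrict_space_iff)
    have restr: "measure (restrict_space \<pi>' (B1 \<times> B2)) C = measure \<pi>' C" if "C \<subseteq> B1 \<times> B2" for C
      using that BB by (simp add: measure_restrict_space)
    \<comment> \<open>The restricted factors have the spaces \<open>B1\<close> and
      \<open>B2\<close>, which turns the criterion into the limiting cross identity.\<close>
    show "measure (restrict_space \<pi>' (B1 \<times> B2)) (A1 \<times> A2) *
          measure (restrict_space \<pi>' (B1 \<times> B2)) (space (restrict_space \<pi>' (B1 \<times> B2))) =
        measure (restrict_space \<pi>' (B1 \<times> B2)) (A1 \<times> space (restrict_space borel B2)) *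
          measure (restrict_space \<pi>' (B1 \<times> B2)) (space (restrict_space borel B1) \<times> A2)"
      using cross[OF A] A by (simp del: space_restrict_space add: space space_restrict_space[of borel] restr Sigma_mono)
  qed
qed

end
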